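(* Let $f:Q\to\mathbb{R}$ be Lipschitz continuous with constant $M_f>0$ and $\gamma$-quasar convex with center $x_*$, $\gamma\in(0,1]$, and let $g:Q\to\mathbb{R}$ be convex and Lipschitz continuous with constant $M_g>0$, where $x_*$ is a solution of $\min\{f(x): x\in Q,\ g(x)\le 0\}$. Let $\Theta_0>0$ satisfy $\sup_{x,y\in Q}V(y,x)\le\Theta_0^2$, let $\varepsilon>0$ and let $x_0\in Q$ be a starting point. Consider the following algorithm. For $k=0,1,2,\dots$: - if $g(x_k)\le\varepsilon$ (productive step), set $M_k=\|\nabla f(x_k)\|_*$, $h_k=\Theta_0\big(\sum_{i=0}^{k}M_i^2\big)^{-1/2}$, $x_{k+1}=\operatorname{Mirr}_{x_k}(h_k\nabla f(x_k))$, and add $k$ to the set $I$ (initially empty); - if $g(x_k)>\varepsilon$ (non-productive step), set $M_k=\|\nabla g(x_k)\|_*$, $h_k=\Theta_0\big(\sum_{i=0}^{k}M_i^2\big)^{-1/2}$, $x_{k+1}=\operatorname{Mirr}_{x_k}(h_k\nabla g(x_k))$. The algorithm stops after the first number $k\ge1$ of performed iterations (indexed $0,\dots,k-1$) for which $$k\ \ge\ \frac{2\Theta_0}{\varepsilon}\Big(1+\frac1\gamma\Big)\Big(\sum_{i=0}^{k-1}M_i^2\Big)^{1/2},$$ and outputs $\hat x=\arg\min_{i\in I}f(x_i)$ (a point $x_i$, $i\in I$, with the smallest value of $f$). Then $I\neq\emptyset$, the algorithm stops after not more than $$\left\lceil\frac{4\max\{M_f^2,M_g^2\}\,\Theta_0^2\big(1+\frac1\gamma\big)^2}{\varepsilon^2}\right\rceil$$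 iterations, and its output satisfies $f(\hat x)-f(x_* )\le\varepsilon$ and $g(\hat x)\le\varepsilon$.
   Context: $(\mathbf{E},\|\cdot\|)$ is a finite-dimensional normed space with dual $\mathbf{E}^*$ and dual norm $\|y\|_*=\max\{\langle y,x\rangle:\|x\|\le1\}$. $Q\subset\mathbf{E}$ is closed and convex. $d:Q\to\mathbb{R}$ is a proper, closed, differentiable function that is $1$-strongly convex with respect to $\|\cdot\|$ (prox-function). The Bregman divergence is $V(y,x)=d(y)-d(x)-\langle\nabla d(x),y-x\rangle$, $x,y\in Q$; it satisfies $V(y,x)\ge\frac12\|y-x\|^2$. The proximal mapping is $\operatorname{Mirr}_x(p)=\arg\min_{u\in Q}\{\langle p,u\rangle+V(u,x)\}$ for $x\in Q$, $p\in\mathbf{E}^*$. For a function $\phi$ on $Q$, $\nabla\phi(x)\in\partial\phi(x)$ denotes an arbitrary (sub)gradient of $\phi$ at $x$. A function $\phi$ is Lipschitz continuous with constant $M$ if $|\phi(x)-\phi(y)|\le M\|x-y\|$ for all $x,y\in Q$; this is understood to mean also $\|\nabla\phi(x)\|_*\le M$ for all $x\in Q$. For $\gamma\in(0,1]$, $f:Q\to\mathbb{R}$ is $\gamma$-quasar convex with center $x_*\in Q$ if $x_*\in\arg\min_{x\in Q}f(x)$ and $f(x_* )\ge f(x)+\frac1\gamma\langle\nabla f(x),x_*-x\rangle$ for all $x\in Q$. The problem is assumed feasible (regular): there is a point $\bar x$ in the interior of $Q$ with $g(\bar x)\le0$. The step sizes are understood to be well defined ($\sum_{i=0}^kM_i^2>0$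 whenever $h_k$ is computed). *)

theory Defs
  imports "HOL-Analysis.Analysis"
begin

text \<open>
  The dual of a normed space \<open>'a\<close> is the type \<open>'a \<Rightarrow>\<^sub>L real\<close> of bounded linear functionals, and its
  operator norm is the dual norm. Functions on \<open>Q\<close> are total functions of which only the values
  on \<open>Q\<close> matter.
\<close>

definition strongly_convex_on ::
    "real \<Rightarrow> 'a::real_normed_vector set \<Rightarrow> ('a \<Rightarrow> real) \<Rightarrow> bool" where
  "strongly_convex_on \<mu> Q d \<longleftrightarrow> convex Q \<and>
     (\<forall>x\<in>Q. \<forall>y\<in>Q. \<forall>t\<in>{0..1}.
        d (t *\<^sub>R x + (1 - t) *\<^sub>R y)
          \<le> t * d x + (1 - t) * d y - \<mu> / 2 * t * (1 - t) * (norm (x - y))\<^sup>2)"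

text \<open>
  Differentiability is relative to \<open>Q\<close> (one-sided at boundary points). A real-valued function is
  proper as soon as \<open>Q\<close> is nonempty; it is closed if its epigraph is.
\<close>

definition prox_function :: "'a::real_normed_vector set \<Rightarrow> ('a \<Rightarrow> real) \<Rightarrow> bool" where
  "prox_function Q d \<longleftrightarrow>
     Q \<noteq> {} \<and> closed (epigraph Q d) \<and> d differentiable_on Q \<and> strongly_convex_on 1 Q d"

text \<open>
  \<open>frechet_derivative\<close> picks some derivative; for convex \<open>Q\<close> with nonempty interior the derivative
  within \<open>Q\<close> is unique, so this is \<open>\<nabla>d(x)\<close>.
\<close>

definition bregman :: "'a::real_normed_vector set \<Rightarrow> ('a \<Rightarrow> real) \<Rightarrow> 'a \<Rightarrow> 'a \<Rightarrow> real" where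
  "bregman Q d y x = d y - d x - frechet_derivative d (at x within Q) (y - x)"

text \<open>The argmin as a set; for a prox-function on a closed convex set in finite dimension it is a
  singleton.\<close>

definition Mirr ::
    "'a::real_normed_vector set \<Rightarrow> ('a \<Rightarrow> real) \<Rightarrow> 'a \<Rightarrow> ('a \<Rightarrow>\<^sub>L real) \<Rightarrow> 'a set" where
  "Mirr Q d x p = {u. is_arg_min (\<lambda>u. blinfun_apply p u + bregman Q d u x) (\<lambda>u. u \<in> Q) u}"

definition convex_subdifferential ::
    "'a::real_normed_vector set \<Rightarrow> ('a \<Rightarrow> real) \<Rightarrow> 'a \<Rightarrow> ('a \<Rightarrow>\<^sub>L real) set" where
  "convex_subdifferential Q \<phi> x = {p. \<forall>y\<in>Q. \<phi> y \<ge> \<phi> x + blinfun_apply p (y - x)}"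

text \<open>
  A quasar-convex function need be neither convex nor differentiable, and for such functions there
  are several notions of subdifferential (Clarke, limiting, Frechet, ...). None of them is singled
  out: \<open>D \<phi> x\<close> stands for \<open>\<partial>\<phi>(x)\<close> in any notion that is the usual subdifferential for convex
  functions and that contains the gradient of a differentiable one. (The convex subdifferential
  itself would not do for all functions: having such a subgradient everywhere forces convexity.)
\<close>

definition subdifferential_notion ::
    "'a::real_normed_vector set \<Rightarrow> (('a \<Rightarrow> real) \<Rightarrow> 'a \<Rightarrow> ('a \<Rightarrow>\<^sub>L real) set) \<Rightarrow> bool" where
  "subdifferential_notion Q D \<longleftrightarrow>
     (\<forall>\<phi>. convex_on Q \<phi> \<longrightarrow> (\<forall>x\<in>Q. D \<phi> x = convex_subdifferential Q \<phi> x)) \<and>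
     (\<forall>\<phi> p. \<forall>x\<in>Q. (\<phi> has_derivative blinfun_apply p) (at x within Q) \<longrightarrow> p \<in> D \<phi> x)"

text \<open>In the following, \<open>G x\<close> is the chosen (sub)gradient \<open>\<nabla>\<phi>(x)\<close>.\<close>

definition Lipschitz_with_gradient ::
    "real \<Rightarrow> 'a::real_normed_vector set \<Rightarrow> ('a \<Rightarrow> real) \<Rightarrow> ('a \<Rightarrow> 'a \<Rightarrow>\<^sub>L real) \<Rightarrow> bool" where
  "Lipschitz_with_gradient M Q \<phi> G \<longleftrightarrow> M-lipschitz_on Q \<phi> \<and> (\<forall>x\<in>Q. norm (G x) \<le> M)"

definition quasar_convex ::
    "real \<Rightarrow> 'a::real_normed_vector set \<Rightarrow> ('a \<Rightarrow> real) \<Rightarrow> ('a \<Rightarrow> 'a \<Rightarrow>\<^sub>L real) \<Rightarrow> 'a \<Rightarrow> bool" where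
  "quasar_convex \<gamma> Q f G c \<longleftrightarrow>
     is_arg_min f (\<lambda>x. x \<in> Q) c \<and>
     (\<forall>x\<in>Q. f c \<ge> f x + 1 / \<gamma> * blinfun_apply (G x) (c - x))"

definition step_gradient ::
    "real \<Rightarrow> ('a::real_normed_vector \<Rightarrow> real) \<Rightarrow> ('a \<Rightarrow> 'a \<Rightarrow>\<^sub>L real) \<Rightarrow> ('a \<Rightarrow> 'a \<Rightarrow>\<^sub>L real)
      \<Rightarrow> 'a \<Rightarrow> 'a \<Rightarrow>\<^sub>L real" where
  "step_gradient \<epsilon> g Gf Gg u = (if g u \<le> \<epsilon> then Gf u else Gg u)"

definition stop_criterion :: "real \<Rightarrow> real \<Rightarrow> real \<Rightarrow> (nat \<Rightarrow> real) \<Rightarrow> nat \<Rightarrow> bool" where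
  "stop_criterion \<Theta> \<epsilon> \<gamma> M k \<longleftrightarrow>
     k \<ge> 1 \<and> real k \<ge> 2 * \<Theta> / \<epsilon> * (1 + 1 / \<gamma>) * sqrt (\<Sum>i<k. (M i)\<^sup>2)"

text \<open>Iteration \<open>k\<close> is performed iff the criterion has not been met for any \<open>j \<le> k\<close>.\<close>

definition performed :: "real \<Rightarrow> real \<Rightarrow> real \<Rightarrow> (nat \<Rightarrow> real) \<Rightarrow> nat \<Rightarrow> bool" where
  "performed \<Theta> \<epsilon> \<gamma> M k \<longleftrightarrow> (\<forall>j\<le>k. \<not> stop_criterion \<Theta> \<epsilon> \<gamma> M j)"

definition stops_after :: "real \<Rightarrow> real \<Rightarrow> real \<Rightarrow> (nat \<Rightarrow> real) \<Rightarrow> nat \<Rightarrow> bool" where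
  "stops_after \<Theta> \<epsilon> \<gamma> M N \<longleftrightarrow>
     stop_criterion \<Theta> \<epsilon> \<gamma> M N \<and> (\<forall>j<N. \<not> stop_criterion \<Theta> \<epsilon> \<gamma> M j)"

text \<open>
  \<open>x\<close> is a run of the method from \<open>x0\<close>, with \<open>M\<close> the norms of the (sub)gradients used. Nothing is
  required of the iterates beyond the last performed iteration. Positivity of the sum says that
  the step size is well defined.
\<close>

definition mirror_descent_run ::
    "'a::real_normed_vector set \<Rightarrow> ('a \<Rightarrow> real) \<Rightarrow> real \<Rightarrow> real \<Rightarrow> real \<Rightarrow> ('a \<Rightarrow> real)
      \<Rightarrow> ('a \<Rightarrow> 'a \<Rightarrow>\<^sub>L real) \<Rightarrow> ('a \<Rightarrow> 'a \<Rightarrow>\<^sub>L real) \<Rightarrow> 'a \<Rightarrow> (nat \<Rightarrow> 'a) \<Rightarrow> (nat \<Rightarrow> real) \<Rightarrow> bool" where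
  "mirror_descent_run Q d \<Theta> \<epsilon> \<gamma> g Gf Gg x0 x M \<longleftrightarrow>
     x 0 = x0 \<and>
     (\<forall>k. performed \<Theta> \<epsilon> \<gamma> M k \<longrightarrow>
        M k = norm (step_gradient \<epsilon> g Gf Gg (x k)) \<and>
        (\<Sum>i\<le>k. (M i)\<^sup>2) > 0 \<and>
        x (Suc k) \<in> Mirr Q d (x k)
          ((\<Theta> / sqrt (\<Sum>i\<le>k. (M i)\<^sup>2)) *\<^sub>R step_gradient \<epsilon> g Gf Gg (x k)))"

definition productive :: "real \<Rightarrow> ('a \<Rightarrow> real) \<Rightarrow> (nat \<Rightarrow> 'a) \<Rightarrow> nat \<Rightarrow> nat set" where
  "productive \<epsilon> g x N = {i. i < N \<and> g (x i) \<le> \<epsilon>}"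

end

theory Submission
  imports Defs
begin

text \<open>
  Write \<open>G\<^sub>k\<close> for the (sub)gradient used in step \<open>k\<close>. The first-order condition for the minimizer
  that defines the step, combined with strong convexity of \<open>d\<close>, gives
  \<open>h\<^sub>k \<langle>G\<^sub>k, x\<^sub>k - y\<rangle> \<le> V(y, x\<^sub>k) - V(y, x\<^sub>k\<^sub>+\<^sub>1) + h\<^sub>k\<^sup>2 M\<^sub>k\<^sup>2 / 2\<close> for all \<open>y \<in> Q\<close> (\<open>Mirr_step_bound\<close>). After
  division by \<open>h\<^sub>k\<close> the divergences no longer telescope, but the weights \<open>1 / h\<^sub>k\<close> increase and \<open>V\<close>
  stays in \<open>[0, \<Theta>\<^sup>2]\<close>, so summation by parts leaves at most \<open>\<Theta>\<^sup>2 / h\<^sub>n\<close>. The errors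
  \<open>h\<^sub>k M\<^sub>k\<^sup>2 / 2\<close> add up to at most \<open>\<Theta> (\<Sum> M\<^sub>i\<^sup>2)\<^sup>1\<^sup>/\<^sup>2\<close>, as \<open>s \<mapsto> 2 \<surd>s\<close> is concave with derivative
  \<open>1 / \<surd>s\<close>. So the sum of \<open>\<langle>G\<^sub>k, x\<^sub>k - y\<rangle>\<close> over a run is at most \<open>2 \<Theta> (\<Sum> M\<^sub>i\<^sup>2)\<^sup>1\<^sup>/\<^sup>2\<close>
  (\<open>adaptive_mirror_descent_regret\<close>).

  Take \<open>y = x\<^sub>*\<close>. At the stopping time \<open>N\<close> the criterion bounds this sum by
  \<open>N \<epsilon> \<gamma> / (1 + \<gamma>)\<close>. A non-productive step contributes more than \<open>\<epsilon>\<close> to it, because \<open>g\<close> is convex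
  and \<open>g(x\<^sub>*) \<le> 0\<close>, and a productive one at least \<open>\<gamma> (f(x\<^sub>k) - f(x\<^sub>*))\<close>, because \<open>f\<close> is quasar-convex.
  So there must be a productive step, and if all of them had \<open>f(x\<^sub>k) - f(x\<^sub>*) > \<epsilon>\<close>, then every
  step would contribute at least \<open>\<gamma> \<epsilon>\<close>, hence more than the bound allows
  (\<open>productive_average\<close> does this count). Since the gradients are bounded, the criterion compares
  \<open>k\<close> with a quantity of order \<open>\<surd>k\<close>, whence the bound on \<open>N\<close>.
\<close>

section \<open>The Bregman divergence and one mirror step\<close>

text \<open>
  Convexity keeps the segment from \<open>x\<close> to \<open>y\<close> inside \<open>Q\<close>, so a derivative relative to \<open>Q\<close> can be
  read off from one-sided difference quotients, also at boundary points. In this form it enters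
  both first-order arguments below.
\<close>

lemma frechet_derivative_within_directional_limit:
  fixes d :: "'a::real_normed_vector \<Rightarrow> real"
  assumes "convex Q" "d differentiable_on Q" and x: "x \<in> Q" and y: "y \<in> Q"
  shows "((\<lambda>t. (d (x + t *\<^sub>R (y - x)) - d x) / t)
           \<longlongrightarrow> frechet_derivative d (at x within Q) (y - x)) (at_right 0)"
proof -
  let ?D = "frechet_derivative d (at x within Q)"
  let ?c = "\<lambda>t::real. x + t *\<^sub>R (y - x)"
  have D: "(d has_derivative ?D) (at x within Q)"
    using assms by (simp add: differentiable_on_def frechet_derivative_works)
  have in_Q: "?c ` {0..1} \<subseteq> Q"
  proof clarify
    fix t :: real assume "t \<in> {0..1}"
    then have "(1 - t) *\<^sub>R x + t *\<^sub>R y \<in> Q"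
      using assms(1) x y by (simp add: convexD_alt)
    then show "?c t \<in> Q" by (simp add: algebra_simps)
  qed
  have "(?c has_derivative (\<lambda>t. t *\<^sub>R (y - x))) (at 0 within {0..1})"
    by (auto intro!: derivative_eq_intros)
  moreover have "(d has_derivative ?D) (at (?c 0) within ?c ` {0..1})"
    using has_derivative_subset[OF D in_Q] by simp
  ultimately have "((d \<circ> ?c) has_derivative (?D \<circ> (\<lambda>t. t *\<^sub>R (y - x)))) (at 0 within {0..1})"
    by (rule diff_chain_within)
  moreover have "?D \<circ> (\<lambda>t. t *\<^sub>R (y - x)) = (*) (?D (y - x))"
    using linear_cmul[OF has_derivative_linear[OF D]] by (auto simp: fun_eq_iff mult.commute)
  ultimately have "((d \<circ> ?c) has_field_derivative ?D (y - x)) (at 0 within {0..1})"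
    by (simp add: has_field_derivative_def)
  then show ?thesis
    by (simp add: has_field_derivative_iff at_within_Icc_at_right)
qed

text \<open>Divide the strong convexity inequality on the segment from \<open>x\<close> to \<open>y\<close> by the
  parameter \<open>t\<close> and let it tend to \<open>0\<close>.\<close>

lemma bregman_ge_half_norm_squared:
  fixes d :: "'a::real_normed_vector \<Rightarrow> real"
  assumes sc: "strongly_convex_on \<mu> Q d" and "d differentiable_on Q"
    and x: "x \<in> Q" and y: "y \<in> Q"
  shows "bregman Q d y x \<ge> \<mu> / 2 * (norm (y - x))\<^sup>2"
proof -
  let ?D = "frechet_derivative d (at x within Q)"
  have "convex Q" using sc by (simp add: strongly_convex_on_def)
  have lim: "((\<lambda>t. d y - d x - \<mu> / 2 * (1 - t) * (norm (y - x))\<^sup>2)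
           \<longlongrightarrow> d y - d x - \<mu> / 2 * (1 - 0) * (norm (y - x))\<^sup>2) (at_right 0)"
    by (intro tendsto_intros)
  have "(d (x + t *\<^sub>R (y - x)) - d x) / t \<le> d y - d x - \<mu> / 2 * (1 - t) * (norm (y - x))\<^sup>2"
    if "0 < t" "t < 1" for t
  proof -
    have "d (t *\<^sub>R y + (1 - t) *\<^sub>R x)
            \<le> t * d y + (1 - t) * d x - \<mu> / 2 * t * (1 - t) * (norm (y - x))\<^sup>2"
      using sc x y that by (simp add: strongly_convex_on_def)
    moreover have "t *\<^sub>R y + (1 - t) *\<^sub>R x = x + t *\<^sub>R (y - x)"
      by (simp add: algebra_simps)
    ultimately have "d (x + t *\<^sub>R (y - x)) - d x
        \<le> (d y - d x - \<mu> / 2 * (1 - t) * (norm (y - x))\<^sup>2) * t"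
      by (simp add: algebra_simps)
    with that show ?thesis by (simp add: pos_divide_le_eq)
  qed
  then have "\<forall>\<^sub>F t in at_right 0.
      (d (x + t *\<^sub>R (y - x)) - d x) / t \<le> d y - d x - \<mu> / 2 * (1 - t) * (norm (y - x))\<^sup>2"
    unfolding eventually_at_right_field by (intro exI[of _ 1]) auto
  then have "?D (y - x) \<le> d y - d x - \<mu> / 2 * (1 - 0) * (norm (y - x))\<^sup>2"
    using tendsto_le[OF _ lim frechet_derivative_within_directional_limit[OF \<open>convex Q\<close> assms(2) x y]]
    by simp
  then show ?thesis by (simp add: bregman_def)
qed

text \<open>
  Moving from the minimizer \<open>u\<close> towards \<open>y\<close> cannot decrease the objective, so its directional
  derivative is nonnegative; the identity
  \<open>V(y,x) - V(y,u) - V(u,x) = \<langle>\<nabla>d(u) - \<nabla>d(x), y - u\<rangle>\<close> turns this into a statement on divergences.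
\<close>

lemma Mirr_three_point:
  fixes d :: "'a::real_normed_vector \<Rightarrow> real"
  assumes "convex Q" "d differentiable_on Q" and x: "x \<in> Q" and y: "y \<in> Q"
    and u: "u \<in> Mirr Q d x p"
  shows "blinfun_apply p (u - y) \<le> bregman Q d y x - bregman Q d y u - bregman Q d u x"
proof -
  let ?Dx = "frechet_derivative d (at x within Q)"
  let ?Du = "frechet_derivative d (at u within Q)"
  have uQ: "u \<in> Q" using u by (simp add: Mirr_def is_arg_min_def)
  have min: "blinfun_apply p u + bregman Q d u x \<le> blinfun_apply p v + bregman Q d v x"
    if "v \<in> Q" for v
    using u that by (auto simp: Mirr_def is_arg_min_linorder)
  have "linear ?Dx"
    using assms(2) x by (auto simp: differentiable_on_def linear_frechet_derivative)
  note lin = linear_add[OF this] linear_diff[OF this] linear_cmul[OF this]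
  have "?Dx (y - u) - blinfun_apply p (y - u) \<le> (d (u + t *\<^sub>R (y - u)) - d u) / t"
    if "0 < t" "t < 1" for t
  proof -
    have "(1 - t) *\<^sub>R u + t *\<^sub>R y \<in> Q"
      using assms(1) uQ y that by (simp add: convexD_alt)
    then have "u + t *\<^sub>R (y - u) \<in> Q" by (simp add: algebra_simps)
    from min[OF this] have "(?Dx (y - u) - blinfun_apply p (y - u)) * t
        \<le> d (u + t *\<^sub>R (y - u)) - d u"
      by (simp add: bregman_def lin blinfun.bilinear_simps algebra_simps)
    with that show ?thesis by (simp add: pos_le_divide_eq)
  qed
  then have "\<forall>\<^sub>F t in at_right 0.
      ?Dx (y - u) - blinfun_apply p (y - u) \<le> (d (u + t *\<^sub>R (y - u)) - d u) / t"
    unfolding eventually_at_right_field by (intro exI[of _ 1]) auto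
  then have "?Dx (y - u) - blinfun_apply p (y - u) \<le> ?Du (y - u)"
    using tendsto_lowerbound[OF frechet_derivative_within_directional_limit[OF assms(1,2) uQ y]]
    by simp
  then show ?thesis by (simp add: bregman_def lin blinfun.bilinear_simps)
qed

text \<open>
  Replacing \<open>u\<close> by \<open>x\<close> in the previous lemma costs \<open>\<langle>p, x - u\<rangle> \<le> \<parallel>p\<parallel>\<^sub>* \<parallel>x - u\<parallel>\<close>, which is
  \<open>\<parallel>p\<parallel>\<^sub>*\<^sup>2 / 2 + \<parallel>x - u\<parallel>\<^sup>2 / 2\<close> at most; strong convexity absorbs the second term in \<open>V(u,x)\<close>.
\<close>

lemma Mirr_step_bound:
  fixes d :: "'a::real_normed_vector \<Rightarrow> real"
  assumes "strongly_convex_on 1 Q d" "d differentiable_on Q" and x: "x \<in> Q" and y: "y \<in> Q"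
    and u: "u \<in> Mirr Q d x p"
  shows "blinfun_apply p (x - y) \<le> bregman Q d y x - bregman Q d y u + (norm p)\<^sup>2 / 2"
proof -
  have "convex Q" using assms(1) by (simp add: strongly_convex_on_def)
  have uQ: "u \<in> Q" using u by (simp add: Mirr_def is_arg_min_def)
  have "blinfun_apply p (x - u) \<le> norm p * norm (u - x)"
    using norm_blinfun[of p "x - u"] by (simp add: norm_minus_commute)
  also have "\<dots> \<le> (norm p)\<^sup>2 / 2 + (norm (u - x))\<^sup>2 / 2"
    using sum_squares_bound[of "norm p" "norm (u - x)"] by simp
  also have "\<dots> \<le> (norm p)\<^sup>2 / 2 + bregman Q d u x"
    using bregman_ge_half_norm_squared[OF assms(1,2) x uQ] by simp
  finally have "blinfun_apply p (x - u) \<le> (norm p)\<^sup>2 / 2 + bregman Q d u x" .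
  moreover have "blinfun_apply p (x - y) = blinfun_apply p (x - u) + blinfun_apply p (u - y)"
    by (simp add: blinfun.bilinear_simps)
  ultimately show ?thesis
    using Mirr_three_point[OF \<open>convex Q\<close> assms(2) x y u] by linarith
qed

section \<open>Regret of mirror descent with adaptive step sizes\<close>

text \<open>
  By monotonicity of the weights, raising the weight of \<open>B - V\<^sub>n\<^sub>+\<^sub>1 \<ge> 0\<close> from \<open>a\<^sub>n\<close> to \<open>a\<^sub>n\<^sub>+\<^sub>1\<close> can only
  increase the bound; keeping the term \<open>- V\<^sub>n\<^sub>+\<^sub>1\<close> is what makes the induction close.
\<close>

lemma weighted_telescope_le:
  fixes a V :: "nat \<Rightarrow> real"
  assumes "\<And>k. k < n \<Longrightarrow> a k \<le> a (Suc k)" "0 \<le> a 0" and "\<And>k. k \<le> n \<Longrightarrow> V k \<le> B"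
  shows "(\<Sum>k\<le>n. a k * (V k - V (Suc k))) \<le> a n * (B - V (Suc n))"
  using assms
proof (induction n)
  case 0
  then show ?case by (simp add: mult_left_mono)
next
  case (Suc n)
  have "a n * (B - V (Suc n)) \<le> a (Suc n) * (B - V (Suc n))"
    using Suc.prems by (intro mult_right_mono) auto
  moreover have "(\<Sum>k\<le>n. a k * (V k - V (Suc k))) \<le> a n * (B - V (Suc n))"
    using Suc by simp
  ultimately show ?case by (simp add: algebra_simps)
qed

text \<open>
  With \<open>s\<^sub>k\<close> the partial sums, the left-hand side is a Riemann sum of \<open>1 / \<surd>s\<close> that evaluates this
  decreasing function at the right end \<open>s\<^sub>k\<close> of each interval \<open>[s\<^sub>k\<^sub>-\<^sub>1, s\<^sub>k]\<close>, hence lies below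
  the integral.
\<close>

lemma sum_divide_sqrt_partial_sums_le:
  fixes c :: "nat \<Rightarrow> real"
  assumes "\<And>k. c k \<ge> 0"
  shows "(\<Sum>k\<le>n. c k / sqrt (\<Sum>i\<le>k. c i)) \<le> 2 * sqrt (\<Sum>i\<le>n. c i)"
proof (induction n)
  case 0
  show ?case using assms[of 0] by (simp add: real_div_sqrt)
next
  case (Suc n)
  define r s where "r = sqrt (\<Sum>i\<le>n. c i)" and "s = sqrt (\<Sum>i\<le>Suc n. c i)"
  have "(\<Sum>i\<le>n. c i) \<ge> 0" "(\<Sum>i\<le>Suc n. c i) \<ge> 0"
    by (intro sum_nonneg assms)+
  then have rs: "r \<ge> 0" "s \<ge> 0" "c (Suc n) = s\<^sup>2 - r\<^sup>2"
    by (simp_all add: r_def s_def)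
  have "r \<le> s" using assms[of "Suc n"] by (simp add: r_def s_def)
  have "c (Suc n) / s \<le> 2 * (s - r)"
  proof (cases "s = 0")
    case False
    have "s\<^sup>2 - r\<^sup>2 \<le> 2 * (s - r) * s"
      using zero_le_power2[of "s - r"] by (simp add: power2_eq_square algebra_simps)
    then show ?thesis using False rs by (simp add: pos_divide_le_eq)
  qed (use \<open>r \<le> s\<close> rs in simp)
  with Suc.IH show ?case by (simp add: r_def s_def)
qed

text \<open>
  With \<open>h\<^sub>k = \<Theta> / (\<Sum>i\<le>k. \<parallel>G\<^sub>i\<parallel>\<^sub>*\<^sup>2)\<^sup>1\<^sup>/\<^sup>2\<close> the telescoped divergences and the accumulated step errors each
  contribute \<open>\<Theta> (\<Sum>i\<le>n. \<parallel>G\<^sub>i\<parallel>\<^sub>*\<^sup>2)\<^sup>1\<^sup>/\<^sup>2\<close>, so that no bound on the gradients or on the number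
  of steps has to be known beforehand.
\<close>

lemma adaptive_mirror_descent_regret:
  fixes d :: "'a::real_normed_vector \<Rightarrow> real" and G :: "nat \<Rightarrow> 'a \<Rightarrow>\<^sub>L real"
  defines "S \<equiv> \<lambda>k. \<Sum>i\<le>k. (norm (G i))\<^sup>2"
  assumes sc: "strongly_convex_on 1 Q d" and diff: "d differentiable_on Q"
    and Theta: "\<Theta> > 0" "\<forall>u\<in>Q. \<forall>v\<in>Q. bregman Q d v u \<le> \<Theta>\<^sup>2"
    and y: "y \<in> Q" and x0: "x 0 \<in> Q"
    and pos: "\<And>k. k \<le> n \<Longrightarrow> S k > 0"
    and step: "\<And>k. k \<le> n \<Longrightarrow> x (Suc k) \<in> Mirr Q d (x k) ((\<Theta> / sqrt (S k)) *\<^sub>R G k)"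
  shows "(\<Sum>k\<le>n. blinfun_apply (G k) (x k - y)) \<le> 2 * \<Theta> * sqrt (S n)"
proof -
  define V where "V k = bregman Q d y (x k)" for k
  define a where "a k = sqrt (S k) / \<Theta>" for k
  have xQ: "x k \<in> Q" if "k \<le> Suc n" for k
    using that x0 step by (cases k) (auto simp: Mirr_def is_arg_min_def)
  have S_mono: "S k \<le> S (Suc k)" for k by (simp add: S_def)
  have one: "blinfun_apply (G k) (x k - y)
      \<le> a k * (V k - V (Suc k)) + \<Theta> / 2 * ((norm (G k))\<^sup>2 / sqrt (S k))" if k: "k \<le> n" for k
  proof -
    define h where "h = \<Theta> / sqrt (S k)"
    have h: "h > 0" "a k = 1 / h" using pos[OF k] Theta by (auto simp: h_def a_def)
    have "h * blinfun_apply (G k) (x k - y) \<le> V k - V (Suc k) + h\<^sup>2 * (norm (G k))\<^sup>2 / 2"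
      using Mirr_step_bound[OF sc diff xQ y step[OF k]] k h
      by (simp add: V_def blinfun.scaleR_left power_mult_distrib flip: h_def)
    then have "blinfun_apply (G k) (x k - y)
        \<le> (V k - V (Suc k) + h\<^sup>2 * (norm (G k))\<^sup>2 / 2) / h"
      using h by (simp add: pos_le_divide_eq mult.commute)
    also have "\<dots> = a k * (V k - V (Suc k)) + h / 2 * (norm (G k))\<^sup>2"
      using h by (simp add: add_divide_distrib power2_eq_square)
    finally show ?thesis by (simp add: h_def)
  qed
  have V: "V k \<le> \<Theta>\<^sup>2" "0 \<le> V k" if "k \<le> Suc n" for k
    using Theta(2)[rule_format, OF xQ[OF that] y]
      order_trans[OF _ bregman_ge_half_norm_squared[OF sc diff xQ[OF that] y], of 0]
    by (simp_all add: V_def)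
  have a_nonneg: "0 \<le> a k" for k
    using Theta by (auto simp: a_def S_def intro!: divide_nonneg_pos sum_nonneg)
  have "(\<Sum>k\<le>n. a k * (V k - V (Suc k))) \<le> a n * (\<Theta>\<^sup>2 - V (Suc n))"
    using Theta S_mono V a_nonneg
    by (intro weighted_telescope_le) (auto simp: a_def divide_right_mono)
  also have "\<dots> \<le> a n * \<Theta>\<^sup>2"
    using V(2)[of "Suc n"] a_nonneg by (intro mult_left_mono) auto
  also have "\<dots> = \<Theta> * sqrt (S n)"
    using Theta by (simp add: a_def power2_eq_square)
  finally have telescope: "(\<Sum>k\<le>n. a k * (V k - V (Suc k))) \<le> \<Theta> * sqrt (S n)" .
  have "(\<Sum>k\<le>n. \<Theta> / 2 * ((norm (G k))\<^sup>2 / sqrt (S k))) \<le> \<Theta> / 2 * (2 * sqrt (S n))"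
    unfolding sum_distrib_left[symmetric] S_def
    using Theta by (intro mult_left_mono sum_divide_sqrt_partial_sums_le) auto
  moreover have "(\<Sum>k\<le>n. blinfun_apply (G k) (x k - y))
      \<le> (\<Sum>k\<le>n. a k * (V k - V (Suc k)) + \<Theta> / 2 * ((norm (G k))\<^sup>2 / sqrt (S k)))"
    using one by (intro sum_mono) auto
  ultimately show ?thesis
    using telescope by (simp add: sum.distrib)
qed

section \<open>Stopping time and quality of the output\<close>

text \<open>If \<open>M\<^sub>i\<^sup>2 \<le> L\<close>, the right-hand side of the criterion is at most \<open>c \<surd>(k L)\<close> with
  \<open>c = 2 \<Theta> (1 + 1 / \<gamma>) / \<epsilon>\<close>, which is below \<open>k\<close> as soon as \<open>k \<ge> c\<^sup>2 L\<close>.\<close>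

lemma stop_criterion_if_bounded:
  assumes pos: "\<Theta> > 0" "\<epsilon> > 0" "\<gamma> > 0"
    and M: "\<And>i. i < k \<Longrightarrow> (M i)\<^sup>2 \<le> L"
    and k: "k \<ge> 1" "real k \<ge> 4 * L * \<Theta>\<^sup>2 * (1 + 1 / \<gamma>)\<^sup>2 / \<epsilon>\<^sup>2"
  shows "stop_criterion \<Theta> \<epsilon> \<gamma> M k"
proof -
  define c where "c = 2 * \<Theta> / \<epsilon> * (1 + 1 / \<gamma>)"
  have "c\<^sup>2 * L = 4 * L * \<Theta>\<^sup>2 * (1 + 1 / \<gamma>)\<^sup>2 / \<epsilon>\<^sup>2"
    unfolding c_def power_mult_distrib power_divide by simp
  then have c2: "c\<^sup>2 * L \<le> real k" using k(2) by simp
  have "(\<Sum>i<k. (M i)\<^sup>2) \<le> real k * L"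
    using sum_bounded_above[of "{..<k}" "\<lambda>i. (M i)\<^sup>2" L] M by simp
  then have "c\<^sup>2 * (\<Sum>i<k. (M i)\<^sup>2) \<le> c\<^sup>2 * (real k * L)"
    by (intro mult_left_mono) auto
  also have "\<dots> \<le> (real k)\<^sup>2"
    using mult_left_mono[OF c2, of "real k"] by (simp add: power2_eq_square mult_ac)
  finally have "(c * sqrt (\<Sum>i<k. (M i)\<^sup>2))\<^sup>2 \<le> (real k)\<^sup>2"
    by (simp add: power_mult_distrib sum_nonneg)
  then have "c * sqrt (\<Sum>i<k. (M i)\<^sup>2) \<le> real k"
    by (rule power2_le_imp_le) simp
  with k(1) show ?thesis by (simp add: stop_criterion_def c_def)
qed

text \<open>
  Here \<open>r k\<close> is the contribution \<open>\<langle>G\<^sub>k, x\<^sub>k - x\<^sub>*\<rangle>\<close> of step \<open>k\<close> and \<open>v\<close> a lower bound for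
  \<open>f(x\<^sub>k) - f(x\<^sub>*)\<close> on the productive steps. If \<open>v > \<epsilon>\<close>, then every \<open>r k\<close> is at least \<open>\<gamma> \<epsilon>\<close>, which
  exceeds the average \<open>\<epsilon> \<gamma> / (1 + \<gamma>)\<close> granted by the bound on the sum. Without any productive step the
  last hypothesis is void for every \<open>v\<close>, also for \<open>v > \<epsilon>\<close>, so the lemma excludes that case as well.
\<close>

lemma productive_average:
  fixes r :: "nat \<Rightarrow> real"
  assumes "N \<ge> 1" "\<epsilon> > 0" "0 < \<gamma>" "\<gamma> \<le> 1"
    and total: "(\<Sum>k<N. r k) \<le> real N * \<epsilon> * \<gamma> / (1 + \<gamma>)"
    and nonproductive: "\<And>k. k < N \<Longrightarrow> k \<notin> I \<Longrightarrow> r k \<ge> \<epsilon>"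
    and productive: "\<And>k. k < N \<Longrightarrow> k \<in> I \<Longrightarrow> r k \<ge> \<gamma> * v"
  shows "v \<le> \<epsilon>"
proof (rule ccontr)
  assume "\<not> v \<le> \<epsilon>"
  then have "\<gamma> * \<epsilon> \<le> \<gamma> * v" "\<gamma> * \<epsilon> \<le> \<epsilon>" using assms by auto
  then have "\<gamma> * \<epsilon> \<le> r k" if "k < N" for k
    using nonproductive[OF that] productive[OF that] by (cases "k \<in> I") auto
  then have "real N * (\<gamma> * \<epsilon>) \<le> (\<Sum>k<N. r k)"
    using sum_bounded_below[of "{..<N}" "\<gamma> * \<epsilon>" r] by simp
  moreover have "real N * \<epsilon> * \<gamma> / (1 + \<gamma>) < real N * (\<gamma> * \<epsilon>)"
    using assms(1-4) by (simp add: pos_divide_less_eq algebra_simps)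
  ultimately show False using total by linarith
qed

theorem theorem3p1:
  fixes Q :: "'a::real_normed_vector set"
    and d f g :: "'a \<Rightarrow> real"
    and D :: "('a \<Rightarrow> real) \<Rightarrow> 'a \<Rightarrow> ('a \<Rightarrow>\<^sub>L real) set"
    and Gf Gg :: "'a \<Rightarrow> 'a \<Rightarrow>\<^sub>L real"
    and Mf Mg \<gamma> \<Theta> \<epsilon> :: real
    and xs x0 :: 'a
    and x :: "nat \<Rightarrow> 'a"
    and M :: "nat \<Rightarrow> real"
  assumes finite_dim: "\<exists>B. finite B \<and> span B = (UNIV :: 'a set)"
    and Q: "closed Q" "convex Q"
    and prox: "prox_function Q d"
    and D: "subdifferential_notion Q D"
    and Gf: "\<forall>u\<in>Q. Gf u \<in> D f u"
    and Gg: "\<forall>u\<in>Q. Gg u \<in> D g u"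
    and f_Lipschitz: "Mf > 0" "Lipschitz_with_gradient Mf Q f Gf"
    and f_quasar: "0 < \<gamma>" "\<gamma> \<le> 1" "quasar_convex \<gamma> Q f Gf xs"
    and g_convex: "convex_on Q g"
    and g_Lipschitz: "Mg > 0" "Lipschitz_with_gradient Mg Q g Gg"
    and solution: "is_arg_min f (\<lambda>u. u \<in> Q \<and> g u \<le> 0) xs"
    and regular: "\<exists>u\<in>interior Q. g u \<le> 0"
    and Theta: "\<Theta> > 0" "\<forall>u\<in>Q. \<forall>v\<in>Q. bregman Q d v u \<le> \<Theta>\<^sup>2"
    and eps: "\<epsilon> > 0"
    and start: "x0 \<in> Q"
    and run: "mirror_descent_run Q d \<Theta> \<epsilon> \<gamma> g Gf Gg x0 x M"
  shows "\<exists>N. stops_after \<Theta> \<epsilon> \<gamma> M N \<and>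
           int N \<le> \<lceil>4 * max (Mf\<^sup>2) (Mg\<^sup>2) * \<Theta>\<^sup>2 * (1 + 1 / \<gamma>)\<^sup>2 / \<epsilon>\<^sup>2\<rceil> \<and>
           productive \<epsilon> g x N \<noteq> {} \<and>
           (\<forall>i. is_arg_min (\<lambda>i. f (x i)) (\<lambda>i. i \<in> productive \<epsilon> g x N) i \<longrightarrow>
                f (x i) - f xs \<le> \<epsilon> \<and> g (x i) \<le> \<epsilon>)"
proof -
  define c where "c = 2 * \<Theta> / \<epsilon> * (1 + 1 / \<gamma>)"
  define L where "L = max (Mf\<^sup>2) (Mg\<^sup>2)"
  define G where "G k = step_gradient \<epsilon> g Gf Gg (x k)" for k
  have sc: "strongly_convex_on 1 Q d" and diff: "d differentiable_on Q"
    using prox by (auto simp: prox_function_def)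
  have xs: "xs \<in> Q" "g xs \<le> 0" using solution by (auto simp: is_arg_min_def)
  have x0: "x 0 \<in> Q" using run start by (simp add: mirror_descent_run_def)
  have run_step: "M k = norm (G k)" "(\<Sum>i\<le>k. (M i)\<^sup>2) > 0"
      "x (Suc k) \<in> Mirr Q d (x k) ((\<Theta> / sqrt (\<Sum>i\<le>k. (M i)\<^sup>2)) *\<^sub>R G k)"
    if "performed \<Theta> \<epsilon> \<gamma> M k" for k
    using run that by (auto simp: mirror_descent_run_def G_def)
  have xQ: "x k \<in> Q" if "performed \<Theta> \<epsilon> \<gamma> M k" for k
  proof (cases k)
    case (Suc j)
    then have "performed \<Theta> \<epsilon> \<gamma> M j" using that by (simp add: performed_def)
    from run_step(3)[OF this] show ?thesis using Suc by (simp add: Mirr_def is_arg_min_def)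
  qed (use x0 in simp)
  have M_le: "(M k)\<^sup>2 \<le> L" if "performed \<Theta> \<epsilon> \<gamma> M k" for k
  proof -
    have "norm (Gf (x k)) \<le> Mf" "norm (Gg (x k)) \<le> Mg"
      using xQ[OF that] f_Lipschitz g_Lipschitz by (auto simp: Lipschitz_with_gradient_def)
    then have "norm (G k) \<le> Mf \<and> g (x k) \<le> \<epsilon> \<or> norm (G k) \<le> Mg"
      by (simp add: G_def step_gradient_def)
    then show ?thesis
      unfolding run_step(1)[OF that] L_def by (auto intro: power_mono simp: le_max_iff_disj)
  qed

  define K where "K = nat \<lceil>4 * L * \<Theta>\<^sup>2 * (1 + 1 / \<gamma>)\<^sup>2 / \<epsilon>\<^sup>2\<rceil>"
  have "L > 0" using f_Lipschitz by (simp add: L_def less_max_iff_disj)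
  then have "4 * L * \<Theta>\<^sup>2 * (1 + 1 / \<gamma>)\<^sup>2 / \<epsilon>\<^sup>2 > 0"
    using Theta eps f_quasar(1) by (intro divide_pos_pos mult_pos_pos zero_less_power)
      (auto simp: add_pos_pos)
  then have K: "K \<ge> 1" "real K \<ge> 4 * L * \<Theta>\<^sup>2 * (1 + 1 / \<gamma>)\<^sup>2 / \<epsilon>\<^sup>2"
      "int K = \<lceil>4 * L * \<Theta>\<^sup>2 * (1 + 1 / \<gamma>)\<^sup>2 / \<epsilon>\<^sup>2\<rceil>"
    by (auto simp: K_def real_nat_ceiling_ge) linarith
  have "\<exists>j\<le>K. stop_criterion \<Theta> \<epsilon> \<gamma> M j"
  proof (rule ccontr)
    assume none: "\<not> ?thesis"
    \<comment> \<open>Only performed iterations have bounded \<open>M\<close>; without a stop up to \<open>K\<close> all of them are performed.\<close>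
    then have "(M i)\<^sup>2 \<le> L" if "i < K" for i
      using that by (intro M_le) (auto simp: performed_def)
    then have "stop_criterion \<Theta> \<epsilon> \<gamma> M K"
      using stop_criterion_if_bounded[OF Theta(1) eps f_quasar(1) _ K(1,2)] by blast
    with none show False by blast
  qed
  then obtain j where j: "j \<le> K" "stop_criterion \<Theta> \<epsilon> \<gamma> M j" by blast
  define N where "N = (LEAST j. stop_criterion \<Theta> \<epsilon> \<gamma> M j)"
  have N: "stops_after \<Theta> \<epsilon> \<gamma> M N"
    unfolding stops_after_def N_def using j(2) by (auto intro: LeastI dest: not_less_Least)
  have "N \<le> K" unfolding N_def using Least_le[of _ j] j by fastforce
  have performed: "performed \<Theta> \<epsilon> \<gamma> M k" if "k < N" for k
    using N that by (auto simp: stops_after_def performed_def)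
  have stop: "N \<ge> 1" "c * sqrt (\<Sum>i<N. (M i)\<^sup>2) \<le> real N"
    using N by (auto simp: stops_after_def stop_criterion_def c_def)

  define r where "r k = blinfun_apply (G k) (x k - xs)" for k
  obtain n where n: "N = Suc n" using stop(1) by (cases N) auto
  have sums: "(\<Sum>i\<le>k. (M i)\<^sup>2) = (\<Sum>i\<le>k. (norm (G i))\<^sup>2)" if "k \<le> n" for k
    using that n run_step(1) performed by (intro sum.cong) auto
  have "(\<Sum>k<N. r k) \<le> 2 * \<Theta> * sqrt (\<Sum>i<N. (M i)\<^sup>2)"
    unfolding r_def n lessThan_Suc_atMost sums[OF order_refl]
  proof (rule adaptive_mirror_descent_regret[where x = x, OF sc diff Theta xs(1) x0])
    fix k assume k: "k \<le> n"
    then have "performed \<Theta> \<epsilon> \<gamma> M k" using performed n by simp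
    from run_step(2,3)[OF this]
    show "(\<Sum>i\<le>k. (norm (G i))\<^sup>2) > 0"
      "x (Suc k) \<in> Mirr Q d (x k) ((\<Theta> / sqrt (\<Sum>i\<le>k. (norm (G i))\<^sup>2)) *\<^sub>R G k)"
      by (simp_all add: sums[OF k])
  qed
  also have "\<dots> = c * sqrt (\<Sum>i<N. (M i)\<^sup>2) * (\<epsilon> * \<gamma> / (1 + \<gamma>))"
  proof -
    have "1 + 1 / \<gamma> = (1 + \<gamma>) / \<gamma>" "1 + \<gamma> \<noteq> 0"
      using f_quasar(1) by (simp_all add: add_divide_distrib)
    then have "c * (\<epsilon> * \<gamma> / (1 + \<gamma>)) = 2 * \<Theta>"
      using eps f_quasar(1) by (simp add: c_def)
    then show ?thesis by (metis mult.assoc mult.commute)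
  qed
  also have "\<dots> \<le> real N * (\<epsilon> * \<gamma> / (1 + \<gamma>))"
    using stop(2) eps f_quasar(1) by (intro mult_right_mono) auto
  finally have total: "(\<Sum>k<N. r k) \<le> real N * \<epsilon> * \<gamma> / (1 + \<gamma>)" by simp

  have nonproductive: "r k \<ge> \<epsilon>" if "k < N" "k \<notin> productive \<epsilon> g x N" for k
  proof -
    have "x k \<in> Q" using xQ performed that by blast
    moreover from this have "Gg (x k) \<in> convex_subdifferential Q g (x k)"
      using D Gg g_convex by (auto simp: subdifferential_notion_def)
    ultimately have "g xs \<ge> g (x k) + blinfun_apply (Gg (x k)) (xs - x k)"
      using xs by (simp add: convex_subdifferential_def)
    moreover have "g (x k) > \<epsilon>" using that by (simp add: productive_def)
    ultimately show ?thesis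
      using xs(2) by (simp add: r_def G_def step_gradient_def blinfun.bilinear_simps)
  qed
  have productive: "r k \<ge> \<gamma> * (f (x k) - f xs)" if "k \<in> productive \<epsilon> g x N" for k
  proof -
    have "k < N" "g (x k) \<le> \<epsilon>" using that by (auto simp: productive_def)
    then have "x k \<in> Q" using xQ performed by blast
    then have "f xs \<ge> f (x k) + 1 / \<gamma> * blinfun_apply (Gf (x k)) (xs - x k)"
      using f_quasar(3) by (simp add: quasar_convex_def)
    then have "f xs \<ge> f (x k) - r k / \<gamma>"
      using \<open>g (x k) \<le> \<epsilon>\<close>
      by (simp add: r_def G_def step_gradient_def blinfun.bilinear_simps diff_divide_distrib)
    then show ?thesis using f_quasar(1) by (simp add: field_simps)
  qed
  note average = productive_average[OF stop(1) eps f_quasar(1,2) total nonproductive]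

  have "productive \<epsilon> g x N \<noteq> {}"
  proof
    assume "productive \<epsilon> g x N = {}"
    then have "\<epsilon> + 1 \<le> \<epsilon>" by (intro average) auto
    then show False by simp
  qed
  moreover have "f (x i) - f xs \<le> \<epsilon> \<and> g (x i) \<le> \<epsilon>"
    if "is_arg_min (\<lambda>i. f (x i)) (\<lambda>i. i \<in> productive \<epsilon> g x N) i" for i
  proof
    have i: "i \<in> productive \<epsilon> g x N" "\<And>k. k \<in> productive \<epsilon> g x N \<Longrightarrow> f (x i) \<le> f (x k)"
      using that by (auto simp: is_arg_min_linorder)
    then show "g (x i) \<le> \<epsilon>" by (simp add: productive_def)
    show "f (x i) - f xs \<le> \<epsilon>"
    proof (rule average)
      fix k assume "k \<in> productive \<epsilon> g x N"
      then have "\<gamma> * (f (x i) - f xs) \<le> \<gamma> * (f (x k) - f xs)"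
        using i(2) f_quasar(1) by (simp add: mult_left_mono)
      also have "\<dots> \<le> r k" using productive \<open>k \<in> productive \<epsilon> g x N\<close> by blast
      finally show "\<gamma> * (f (x i) - f xs) \<le> r k" .
    qed
  qed
  moreover have "int N \<le> \<lceil>4 * max (Mf\<^sup>2) (Mg\<^sup>2) * \<Theta>\<^sup>2 * (1 + 1 / \<gamma>)\<^sup>2 / \<epsilon>\<^sup>2\<rceil>"
    using \<open>N \<le> K\<close> K(3) by (simp flip: L_def)
  ultimately show ?thesis using N by blast
qed

end
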